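(* For every integer $\tau\le 0$ and every integer $m\ge 1$, the element $$f_{m}^{\tau}(q)=(q^{1/2}-q^{-1/2})\,[x^m]\,\mathrm{Log}\left(\sum_{n\geq 0}\frac{(-1)^{n(\tau-1)}q^{\frac{n(n-1)}{2}\tau+\frac{n^2}{2}}}{(1-q)(1-q^2)\cdots(1-q^n)}x^n\right)$$ lies in $\mathbb{Z}[q^{\pm\frac12}]$; that is, $f_m^\tau(q)=\sum_{k\in\mathbb{Z}}N_{m,k}(\tau)q^{k/2}$ with integers $N_{m,k}(\tau)$, only finitely many of which (for fixed $m$) are nonzero.
   Context: For a power series $F\in 1+x\,\mathbb{Q}(q^{1/2})[[x]]$, the plethystic logarithm is $$\mathrm{Log}(F)=\sum_{d\ge 1}\frac{\mu(d)}{d}\Psi_d(\log F),$$ where $\mu$ is the Möbius function and $\Psi_d$ is the $\mathbb{Q}$-algebra map replacing $x$ by $x^d$ and $q^{1/2}$ by $q^{d/2}$. $[x^m]G$ denotes the coefficient of $x^m$ in the series $G$. *)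

theory Defs
  imports
    "HOL-Computational_Algebra.Computational_Algebra"
    "HOL-Computational_Algebra.Field_as_Ring"
begin

definition moebius_mu :: "nat \<Rightarrow> int" where
  "moebius_mu n = (if squarefree n then (-1) ^ card (prime_factors n) else 0)"

text \<open>
  The coefficient field $\mathbb{Q}(q^{1/2})$ is realised as the field of fractions of
  $\mathbb{Q}[t]$, with $t = q^{1/2}$.
\<close>

type_synonym coeff_field = "rat poly fract"

definition qhalf :: coeff_field where
  "qhalf = to_fract [:0, 1:]"

definition qvar :: coeff_field where
  "qvar = qhalf ^ 2"

text \<open>
  The substitution $t \mapsto t^d$ on $\mathbb{Q}(t)$, given on the reduced representation of a
  fraction. For \<open>d > 0\<close> it does not depend on the representation; for \<open>d = 0\<close> it is
  meaningless and never used.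
\<close>

definition subst_qhalf :: "nat \<Rightarrow> coeff_field \<Rightarrow> coeff_field" where
  "subst_qhalf d r =
     (case quot_of_fract r of (a, b) \<Rightarrow>
        Fraction_Field.Fract (a \<circ>\<^sub>p monom 1 d) (b \<circ>\<^sub>p monom 1 d))"

lemma subst_qhalf_Fract:
  assumes "d > 0" "b \<noteq> 0"
  shows "subst_qhalf d (Fraction_Field.Fract a b) =
           Fraction_Field.Fract (a \<circ>\<^sub>p monom 1 d) (b \<circ>\<^sub>p monom 1 d)"
proof -
  obtain a' b' where ab: "quot_of_fract (Fraction_Field.Fract a b) = (a', b')"
    by fastforce
  have eq: "Fraction_Field.Fract a' b' = Fraction_Field.Fract a b"
    using quot_to_fract_quot_of_fract[of "Fraction_Field.Fract a b"]
    unfolding ab quot_to_fract_def by simp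
  have b': "b' \<noteq> 0"
    using snd_quot_of_fract_nonzero[of "Fraction_Field.Fract a b"] ab by simp
  have nz: "p \<circ>\<^sub>p monom 1 d \<noteq> 0" if "p \<noteq> 0" for p :: "rat poly"
    using that assms(1) by (simp add: pcompose_eq_0_iff degree_monom_eq)
  have "a' * b = a * b'"
    using eq b' assms(2) by (simp add: eq_fract)
  then have "(a' \<circ>\<^sub>p monom 1 d) * (b \<circ>\<^sub>p monom 1 d) = (a \<circ>\<^sub>p monom 1 d) * (b' \<circ>\<^sub>p monom 1 d)"
    by (metis pcompose_mult)
  then show ?thesis
    unfolding subst_qhalf_def ab using nz[OF b'] nz[OF assms(2)] by (simp add: eq_fract)
qed

definition Psi :: "nat \<Rightarrow> coeff_field fps \<Rightarrow> coeff_field fps" where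
  "Psi d F = Abs_fps (\<lambda>n. subst_qhalf d (fps_nth F n)) oo fps_X ^ d"

text \<open>
  \<open>fps_ln 1\<close> is the series $\log(1+x)$, so \<open>fps_log F\<close> is $\log F$ whenever \<open>F\<close> has
  constant term 1.
\<close>

definition fps_log :: "coeff_field fps \<Rightarrow> coeff_field fps" where
  "fps_log F = fps_ln 1 oo (F - 1)"

text \<open>
  The sum over $d \ge 1$ is taken in the $x$-adic topology, with $d = k + 1$.
\<close>

definition pleth_Log :: "coeff_field fps \<Rightarrow> coeff_field fps" where
  "pleth_Log F =
     (\<Sum>k. fps_const (of_int (moebius_mu (Suc k)) / of_nat (Suc k)) * Psi (Suc k) (fps_log F))"

lemma Psi_nth:
  assumes "d > 0"
  shows "fps_nth (Psi d F) n = (if d dvd n then subst_qhalf d (fps_nth F (n div d)) else 0)"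
  using assms by (simp add: Psi_def fps_nth_compose_X_power)

lemma fps_log_nth_0: "fps_nth (fps_log F) 0 = 0"
  by (simp add: fps_log_def)

lemma pleth_Log_sums:
  "(\<lambda>k. fps_const (of_int (moebius_mu (Suc k)) / of_nat (Suc k)) * Psi (Suc k) (fps_log F))
     sums pleth_Log F" (is "?f sums _")
  and pleth_Log_nth:
  "fps_nth (pleth_Log F) n =
     (\<Sum>d=1..n. of_int (moebius_mu d) / of_nat d * fps_nth (Psi d (fps_log F)) n)"
proof -
  define L where "L = Abs_fps (\<lambda>n.
     \<Sum>d=1..n. of_int (moebius_mu d) / of_nat d * fps_nth (Psi d (fps_log F)) n)"
  have s0: "subst_qhalf d 0 = 0" for d
    by (simp add: subst_qhalf_def fract_collapse)
  have van: "fps_nth (?f k) n = 0" if "k \<ge> n" for k n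
  proof (cases "n = 0")
    case True
    then show ?thesis by (simp add: Psi_nth fps_log_nth_0 s0)
  next
    case False
    then have "\<not> Suc k dvd n" using that by (auto dest: dvd_imp_le)
    then show ?thesis by (simp add: Psi_nth)
  qed
  have part: "fps_nth (\<Sum>k<N. ?f k) n = fps_nth L n" if "N \<ge> n" for N n
  proof -
    have "fps_nth (\<Sum>k<N. ?f k) n = (\<Sum>k<N. fps_nth (?f k) n)"
      by (rule fps_sum_nth)
    also have "\<dots> = (\<Sum>k<n. fps_nth (?f k) n)"
      using that van by (intro sum.mono_neutral_right) auto
    also have "\<dots> = fps_nth L n"
      unfolding L_def fps_nth_Abs_fps
      by (rule sum.reindex_bij_witness[of _ "\<lambda>d. d - 1" Suc]) auto
    finally show ?thesis .
  qed
  have sums: "?f sums L"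
    unfolding sums_def tendsto_fps_iff
    using part by (auto intro: eventually_sequentiallyI)
  then have "pleth_Log F = L"
    unfolding pleth_Log_def by (rule sums_unique[symmetric])
  then show "?f sums pleth_Log F" and "fps_nth (pleth_Log F) n =
     (\<Sum>d=1..n. of_int (moebius_mu d) / of_nat d * fps_nth (Psi d (fps_log F)) n)"
    using sums by (simp_all add: L_def)
qed

text \<open>
  The exponent of $q$ in the numerator may be a half-integer, so the numerator is written as a
  power of $q^{1/2}$ with the exponent $n(n-1)\tau/2 + n^2/2$ doubled.
\<close>

definition gen_series :: "int \<Rightarrow> coeff_field fps" where
  "gen_series \<tau> = Abs_fps (\<lambda>n.
     (-1) powi (int n * (\<tau> - 1)) * qhalf powi (int n * (int n - 1) * \<tau> + (int n)\<^sup>2)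
       / (\<Prod>i=1..n. 1 - qvar ^ i))"

lemma gen_series_nth_0: "fps_nth (gen_series \<tau>) 0 = 1"
  by (simp add: gen_series_def)

definition f_tau :: "int \<Rightarrow> nat \<Rightarrow> coeff_field" where
  "f_tau \<tau> m = (qhalf - inverse qhalf) * fps_nth (pleth_Log (gen_series \<tau>)) m"

end

theory Submission
  imports Defs
begin

text \<open>
  Write \<open>t\<close> for \<open>q ^ (1/2)\<close>, \<open>p = 1 / q\<close>, \<open>s = - \<tau> \<ge> 0\<close> and \<open>F\<close> for the generating series.
  The ratio of consecutive coefficients of \<open>F\<close> gives
  \<open>F(x) = F(q x) - (-1) ^ s t x F(q p ^ s x)\<close>. Dividing by \<open>F(q x)\<close> shows that
  \<open>F(x) / F(q x) = V(t x)\<close>, where \<open>V\<close> solves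
  \<open>V(y) = 1 - (-1) ^ s y V(y) V(p y) \<dots> V(p ^ (s - 1) y)\<close>. This equation determines \<open>V\<close>
  recursively and without any division, so \<open>V\<close> comes from a single power series
  \<open>q_fix s\<close> with coefficients in \<open>\<int>[X]\<close>, evaluated at \<open>X = p\<close>.

  Let \<open>w\<close> be the logarithmic derivative \<open>y V' / V\<close> of \<open>q_fix s\<close>, again over \<open>\<int>[X]\<close>. Comparing
  coefficients of the logarithms of \<open>F(x)\<close> and \<open>F(q x)\<close>, the \<open>n\<close>-th coefficient of \<open>log F\<close> is
  \<open>t ^ n w_n(p) / (n (1 - q ^ n))\<close>. The denominators \<open>1 - q ^ m\<close> produced by the different divisors
  of \<open>m\<close> in the plethystic logarithm coincide, and its \<open>m\<close>-th coefficient becomes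
  \<open>t ^ m T_m(p) / (m (1 - q ^ m))\<close> with \<open>T_m = \<Sum> \<mu>(d) w_{m/d}(X ^ d)\<close>, the sum running over the
  divisors \<open>d\<close> of \<open>m\<close> (\<open>dlog_moebius s m\<close> below). Since \<open>t - 1/t = t (1 - p)\<close> and
  \<open>1 - q ^ m\<close> is a unit times \<open>1 - p ^ m\<close>, the claim reduces to one statement in \<open>\<int>[X]\<close>: the
  polynomial \<open>T_m\<close> is divisible by \<open>m (1 + X + \<dots> + X ^ (m - 1))\<close>. The two factors are treated
  separately, which suffices because the second one is monic.

  \<^item> Divisibility by \<open>m\<close> (\<open>moebius_dlog_dvd\<close>) holds for every power series over \<open>\<int>[X]\<close> with
    constant term 1. Such a series is a product of powers of factors \<open>1 - X ^ i y ^ n\<close> with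
    integer exponents; for a product of this kind \<open>w_m = \<Sum> n C_n(X ^ (m/n))\<close> over the divisors
    \<open>n\<close> of \<open>m\<close>, and Moebius inversion gives \<open>T_m = m C_m\<close>.

  \<^item> Divisibility by \<open>1 + X + \<dots> + X ^ (m - 1)\<close> means that \<open>T_m\<close> vanishes at every complex number
    \<open>z \<noteq> 1\<close> with \<open>z ^ m = 1\<close>. If \<open>z\<close> has order \<open>r\<close>, then
    \<open>V_z(y) V_z(z y) \<dots> V_z(z ^ (r - 1) y) = V_1(y ^ r)\<close>
    (\<open>prod_dilates_root_of_unity\<close>). This is an instance of the rule \<open>(A + B) ^ r = A ^ r + B ^ r\<close>
    for operators with \<open>A B = z B A\<close>, that is, of the vanishing of the
    Gaussian binomial coefficients at \<open>z\<close>. Taking logarithmic derivatives,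
    \<open>w_n(z) = w_{n/r}(1)\<close> whenever \<open>r\<close> divides \<open>n\<close>. Now choose a prime \<open>l\<close> dividing \<open>r\<close>; the
    summands of \<open>T_m(z)\<close> belonging to \<open>d\<close> and \<open>l d\<close> cancel.
\<close>

unbundle fps_syntax

section \<open>Evaluating integer polynomials\<close>

text \<open>
  All ring homomorphisms out of \<open>\<int>[X]\<close> used below are evaluations, including the substitution
  \<open>X \<mapsto> X ^ d\<close>, which is evaluation at \<open>monom 1 d\<close>.
\<close>

definition ev :: "'a::comm_ring_1 \<Rightarrow> int poly \<Rightarrow> 'a" where
  "ev a f = poly (map_poly of_int f) a"

lemma ev_0 [simp]: "ev a 0 = 0"
  and ev_1 [simp]: "ev a 1 = 1"
  and ev_pCons: "ev a (pCons c f) = of_int c + a * ev a f"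
  by (simp_all add: ev_def map_poly_pCons)

lemma ev_add [simp]: "ev a (f + g) = ev a f + ev a g"
proof -
  have "map_poly of_int (f + g) = map_poly of_int f + (map_poly of_int g :: 'a poly)"
    by (intro poly_eqI) (simp add: coeff_map_poly)
  then show ?thesis by (simp add: ev_def)
qed

lemma ev_smult: "ev a (smult c f) = of_int c * ev a f"
  by (induction f) (simp_all add: ev_pCons algebra_simps)

lemma ev_mult [simp]: "ev a (f * g) = ev a f * ev a g"
  by (induction f) (simp_all add: ev_pCons ev_smult algebra_simps)

lemma ev_minus [simp]: "ev a (- f) = - ev a f"
  using ev_smult[of a "-1" f] by simp

lemma ev_diff [simp]: "ev a (f - g) = ev a f - ev a g"
  using ev_add[of a f "- g"] by (simp del: ev_add)

lemma ev_sum [simp]: "ev a (sum f A) = (\<Sum>x\<in>A. ev a (f x))"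
  by (induction A rule: infinite_finite_induct) simp_all

lemma ev_power [simp]: "ev a (f ^ n) = ev a f ^ n"
  by (induction n) simp_all

lemma ev_monom [simp]: "ev a (monom c n) = of_int c * a ^ n"
  by (simp add: ev_def map_poly_monom poly_monom)

lemma ev_of_int [simp]: "ev a (of_int c) = of_int c"
  using ev_monom[of a c 0] by (simp add: monom_0 of_int_poly)

lemma ev_of_nat [simp]: "ev a (of_nat c) = of_nat c"
  using ev_of_int[of a "int c"] by simp

lemma ev_eq_sum: "ev a f = (\<Sum>i\<le>degree f. of_int (coeff f i) * a ^ i)"
  by (subst poly_as_sum_of_monoms[of f, symmetric]) (simp only: ev_sum ev_monom)

lemma ev_ev_monom [simp]: "ev a (ev (monom 1 d) f) = ev (a ^ d) f"
  by (induction f) (simp_all add: ev_pCons)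

lemma ev_monom_1_1 [simp]: "ev (monom 1 (Suc 0)) f = f"
  by (induction f) (simp_all add: ev_pCons monom_altdef pCons_one of_int_poly)

definition fps_ev :: "'a::comm_ring_1 \<Rightarrow> int poly fps \<Rightarrow> 'a fps" where
  "fps_ev a F = Abs_fps (\<lambda>n. ev a (F $ n))"

lemma fps_ev_nth [simp]: "fps_ev a F $ n = ev a (F $ n)"
  by (simp add: fps_ev_def)

lemma fps_ev_1 [simp]: "fps_ev a 1 = 1"
  and fps_ev_X [simp]: "fps_ev a fps_X = fps_X"
  and fps_ev_diff [simp]: "fps_ev a (F - G) = fps_ev a F - fps_ev a G"
  and fps_ev_minus [simp]: "fps_ev a (- F) = - fps_ev a F"
  by (simp_all add: fps_eq_iff fps_X_def)

lemma fps_ev_mult [simp]: "fps_ev a (F * G) = fps_ev a F * fps_ev a G"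
  by (simp add: fps_eq_iff fps_mult_nth)

lemma fps_ev_power [simp]: "fps_ev a (F ^ n) = fps_ev a F ^ n"
  by (induction n) simp_all

lemma fps_ev_prod [simp]: "fps_ev a (prod F A) = (\<Prod>x\<in>A. fps_ev a (F x))"
  by (induction A rule: infinite_finite_induct) simp_all

section \<open>Logarithmic derivatives of power series\<close>

text \<open>
  For a series with constant term 1 this is \<open>x f' / f\<close>. It replaces the logarithm over rings in
  which integers are not invertible, and turns the integrality questions into questions about
  polynomials with integer coefficients.
\<close>

definition dlog :: "'a::idom fps \<Rightarrow> 'a fps" where
  "dlog f = fps_X * fps_deriv f * fps_right_inverse f 1"

lemma dlog_mult_self: "f $ 0 = 1 \<Longrightarrow> dlog f * f = fps_X * fps_deriv f"
  using fps_right_inverse[of f 1] by (simp add: dlog_def mult.assoc mult.commute[of _ f])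

lemma dlog_unique:
  assumes "f $ 0 = 1" and "w * f = fps_X * fps_deriv f"
  shows "dlog f = w"
proof -
  have "f \<noteq> 0" using assms(1) by auto
  then show ?thesis
    using dlog_mult_self[OF assms(1)] assms(2) by (metis mult_right_cancel)
qed

lemma dlog_nth_0 [simp]: "dlog f $ 0 = 0"
  by (simp add: dlog_def mult.assoc)

lemma dlog_1 [simp]: "dlog 1 = 0"
  by (rule dlog_unique) simp_all

lemma dlog_mult:
  assumes "f $ 0 = 1" "g $ 0 = 1"
  shows "dlog (f * g) = dlog f + dlog g"
proof (rule dlog_unique)
  show "(dlog f + dlog g) * (f * g) = fps_X * fps_deriv (f * g)"
    using dlog_mult_self[OF assms(1)] dlog_mult_self[OF assms(2)]
    by (simp add: distrib_right distrib_left mult.assoc mult.left_commute[of _ f]) (simp add: mult_ac)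
qed (use assms in simp)

lemma prod_nth_0: "(\<And>x. x \<in> A \<Longrightarrow> f x $ 0 = 1) \<Longrightarrow> prod f A $ 0 = (1 :: 'a::idom)"
  by (induction A rule: infinite_finite_induct) simp_all

lemma dlog_prod:
  assumes "\<And>x. x \<in> A \<Longrightarrow> f x $ 0 = 1"
  shows "dlog (prod f A) = (\<Sum>x\<in>A. dlog (f x))"
  using assms
  by (induction A rule: infinite_finite_induct) (simp_all add: dlog_mult prod_nth_0)

lemma dlog_right_inverse:
  assumes "f $ 0 = 1"
  shows "dlog (fps_right_inverse f 1) = - dlog f"
proof -
  have "dlog (f * fps_right_inverse f 1) = dlog f + dlog (fps_right_inverse f 1)"
    by (rule dlog_mult) (use assms in simp_all)
  moreover have "f * fps_right_inverse f 1 = 1"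
    using assms by (intro fps_right_inverse) simp
  ultimately show ?thesis by (simp add: add_eq_0_iff)
qed

lemma dlog_dilate:
  assumes "f $ 0 = 1"
  shows "dlog (f oo (fps_const c * fps_X)) = dlog f oo (fps_const c * fps_X)"
proof (rule dlog_unique)
  have "(dlog f oo (fps_const c * fps_X)) * (f oo (fps_const c * fps_X))
      = (fps_X * fps_deriv f) oo (fps_const c * fps_X)"
    by (simp add: dlog_mult_self[OF assms] flip: fps_compose_mult_distrib)
  also have "\<dots> = fps_X * fps_deriv (f oo (fps_const c * fps_X))"
    by (rule fps_ext) (simp add: fps_X_mult_nth)
  finally show "(dlog f oo (fps_const c * fps_X)) * (f oo (fps_const c * fps_X)) =
    fps_X * fps_deriv (f oo (fps_const c * fps_X))" .
qed (use assms in simp)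

lemma dlog_compose_X_power:
  assumes "f $ 0 = 1" "r > 0"
  shows "dlog (f oo fps_X ^ r) = of_nat r * (dlog f oo fps_X ^ r)"
proof (rule dlog_unique)
  have "(of_nat r * (dlog f oo fps_X ^ r)) * (f oo fps_X ^ r)
      = of_nat r * ((fps_X * fps_deriv f) oo fps_X ^ r)"
    using assms(2) by (simp add: dlog_mult_self[OF assms(1)] mult.assoc flip: fps_compose_mult_distrib)
  also have "\<dots> = fps_X * fps_deriv (f oo fps_X ^ r)"
  proof (rule fps_ext)
    fix n
    show "(of_nat r * ((fps_X * fps_deriv f) oo fps_X ^ r)) $ n
        = (fps_X * fps_deriv (f oo fps_X ^ r)) $ n"
      using assms(2)
      by (cases "n = 0")
        (auto simp: fps_mult_of_nat_nth fps_nth_compose_X_power elim!: dvdE simp flip: of_nat_mult)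
  qed
  finally show "(of_nat r * (dlog f oo fps_X ^ r)) * (f oo fps_X ^ r)
      = fps_X * fps_deriv (f oo fps_X ^ r)" .
qed (use assms in simp)

lemma dlog_fps_ev:
  assumes "f $ 0 = 1"
  shows "dlog (fps_ev a f) = fps_ev a (dlog f)"
proof (rule dlog_unique)
  have "fps_ev a (dlog f) * fps_ev a f = fps_ev a (fps_X * fps_deriv f)"
    by (simp only: dlog_mult_self[OF assms] flip: fps_ev_mult)
  also have "\<dots> = fps_X * fps_deriv (fps_ev a f)"
    by (rule fps_ext) (simp add: fps_X_mult_nth)
  finally show "fps_ev a (dlog f) * fps_ev a f = fps_X * fps_deriv (fps_ev a f)" .
qed (use assms in simp)

section \<open>Moebius sums\<close>

lemma moebius_mu_prime_mult:
  assumes "prime l" "\<not> l dvd d"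
  shows "moebius_mu (l * d) = - moebius_mu d"
proof (cases "squarefree d")
  case True
  have d: "d \<noteq> 0" using assms(2) by (metis dvd_0_right)
  have "coprime l d" using assms by (simp add: prime_imp_coprime)
  then have "squarefree (l * d)"
    using True assms(1) by (intro squarefree_mult_coprime) (auto intro: squarefree_prime)
  moreover have "prime_factors (l * d) = insert l (prime_factors d)"
    using d assms(1) by (simp add: prime_factors_product prime_prime_factors)
  moreover have "l \<notin> prime_factors d" using assms(2) by auto
  ultimately show ?thesis using True by (simp add: moebius_mu_def)
next
  case False
  then have "\<not> squarefree (l * d)" by (meson dvd_triv_right squarefree_mono)
  with False show ?thesis by (simp add: moebius_mu_def)
qed

lemma moebius_mu_eq_0: "prime l \<Longrightarrow> l * l dvd d \<Longrightarrow> moebius_mu d = 0"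
  by (auto simp: moebius_mu_def squarefree_def power2_eq_square)

text \<open>
  Only squarefree \<open>d\<close> contribute, and these come in pairs \<open>d\<close>, \<open>l d\<close> with \<open>d\<close> prime to \<open>l\<close>,
  whose Moebius values are opposite. The same pairing gives both the usual Moebius inversion
  and the vanishing at roots of unity.
\<close>

lemma moebius_sum_eq_0:
  fixes h :: "nat \<Rightarrow> 'a::comm_ring_1"
  assumes "m > 0" "prime l" "l dvd m"
    and h: "\<And>d. \<not> l dvd d \<Longrightarrow> l * d dvd m \<Longrightarrow> h (l * d) = h d"
  shows "(\<Sum>d | d dvd m. of_int (moebius_mu d) * h d) = 0"
proof -
  define A where "A = {d. d dvd m \<and> \<not> l dvd d}"
  define B where "B = {d. d dvd m \<and> l dvd d}"
  have fin: "finite A" "finite B" using assms(1) by (auto simp: A_def B_def)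
  have l0: "l > 0" using assms(2) by (simp add: prime_gt_0_nat)
  have mem: "l * d dvd m" if "d \<in> A" for d
    using that assms(2,3) unfolding A_def
    by (auto intro!: divides_mult simp: prime_imp_coprime)
  have "(\<Sum>d\<in>B. of_int (moebius_mu d) * h d) = (\<Sum>d\<in>(*) l ` A. of_int (moebius_mu d) * h d)"
  proof (rule sum.mono_neutral_right[OF fin(2)])
    show "(*) l ` A \<subseteq> B" using mem by (auto simp: B_def)
    show "\<forall>d\<in>B - (*) l ` A. of_int (moebius_mu d) * h d = 0"
    proof
      fix d assume d: "d \<in> B - (*) l ` A"
      then obtain e where e: "d = l * e" by (auto simp: B_def elim: dvdE)
      have "e dvd m" using d e by (auto simp: B_def intro: dvd_mult_right)
      then have "l dvd e" using d e by (auto simp: A_def)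
      then show "of_int (moebius_mu d) * h d = 0"
        using moebius_mu_eq_0[OF assms(2), of d] e by simp
    qed
  qed
  also have "\<dots> = (\<Sum>d\<in>A. of_int (moebius_mu (l * d)) * h (l * d))"
    using l0 by (subst sum.reindex) (auto simp: inj_on_def)
  also have "\<dots> = - (\<Sum>d\<in>A. of_int (moebius_mu d) * h d)"
    unfolding sum_negf[symmetric]
  proof (rule sum.cong)
    fix d assume "d \<in> A"
    then show "of_int (moebius_mu (l * d)) * h (l * d) = - (of_int (moebius_mu d) * h d)"
      using h[of d] mem[of d] moebius_mu_prime_mult[OF assms(2), of d] by (simp add: A_def)
  qed simp
  finally have "(\<Sum>d\<in>A. of_int (moebius_mu d) * h d) + (\<Sum>d\<in>B. of_int (moebius_mu d) * h d) = 0"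
    by simp
  moreover have "{d. d dvd m} = A \<union> B" "A \<inter> B = {}" by (auto simp: A_def B_def)
  ultimately show ?thesis using fin by (simp add: sum.union_disjoint)
qed

lemma moebius_sum_divisors:
  assumes "n > 0"
  shows "(\<Sum>d | d dvd n. moebius_mu d) = (if n = 1 then 1 else 0)"
proof (cases "n = 1")
  case True
  have "{d. d dvd (1::nat)} = {1}" by auto
  then show ?thesis using True by (simp add: moebius_mu_def)
next
  case False
  then obtain l where "prime l" "l dvd n" using prime_factor_nat by blast
  then show ?thesis using moebius_sum_eq_0[of n l "\<lambda>_. 1 :: int"] False assms by simp
qed

section \<open>Gauss congruences for logarithmic derivatives\<close>

text \<open>
  If \<open>C = \<Sum> c_i X ^ i\<close>, this is the logarithmic derivative of
  \<open>\<Prod> (1 - X ^ i y ^ n) ^ (- c_i)\<close>, the plethystic exponential of \<open>C y ^ n\<close>.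
\<close>

definition factor_dlog :: "nat \<Rightarrow> int poly \<Rightarrow> int poly fps" where
  "factor_dlog n C =
     Abs_fps (\<lambda>j. if n dvd j \<and> j > 0 then of_nat n * ev (monom 1 (j div n)) C else 0)"

text \<open>
  The polynomials \<open>C\<close> with this property form a group under addition, because \<open>dlog\<close> turns products
  into sums; the factor \<open>1 - X ^ i y ^ n\<close> takes care of \<open>- X ^ i\<close>, and the monomials generate
  \<open>\<int>[X]\<close>.
\<close>

lemma ex_factor:
  assumes "n > 0"
  shows "\<exists>E. E $ 0 = 1 \<and> dlog E = factor_dlog n C"
proof -
  define P where "P C \<longleftrightarrow> (\<exists>E. E $ 0 = 1 \<and> dlog E = factor_dlog n C)" for C
  have P0: "P 0" unfolding P_def by (rule exI[of _ 1]) (simp add: factor_dlog_def fps_eq_iff)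
  have Padd: "P (C + D)" if "P C" "P D" for C D
  proof -
    from that obtain E F where "E $ 0 = 1" "dlog E = factor_dlog n C"
      "F $ 0 = 1" "dlog F = factor_dlog n D" by (auto simp: P_def)
    then show ?thesis unfolding P_def
      by (intro exI[of _ "E * F"])
        (simp add: dlog_mult factor_dlog_def fps_eq_iff algebra_simps)
  qed
  have Pneg: "P (- C)" if "P C" for C
  proof -
    from that obtain E where "E $ 0 = 1" "dlog E = factor_dlog n C" by (auto simp: P_def)
    then show ?thesis unfolding P_def
      by (intro exI[of _ "fps_right_inverse E 1"])
        (simp add: dlog_right_inverse factor_dlog_def fps_eq_iff)
  qed
  have Pmonom: "P (- monom 1 i)" for i
  proof -
    define E :: "int poly fps" where "E = (1 - fps_const (monom 1 i) * fps_X) oo fps_X ^ n"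
    define w :: "int poly fps" where "w = Abs_fps (\<lambda>j. if j = 0 then 0 else - (monom 1 i ^ j))"
    have "dlog (1 - fps_const (monom 1 i) * fps_X) = w"
    proof (rule dlog_unique)
      show "w * (1 - fps_const (monom 1 i) * fps_X)
          = fps_X * fps_deriv (1 - fps_const (monom 1 i) * fps_X)"
      proof (rule fps_ext)
        fix j
        show "(w * (1 - fps_const (monom 1 i) * fps_X)) $ j
          = (fps_X * fps_deriv (1 - fps_const (monom 1 i) * fps_X)) $ j"
        proof (cases j)
          case (Suc k)
          have "w * (1 - fps_const (monom 1 i) * fps_X) = w - fps_const (monom 1 i) * (fps_X * w)"
            by (simp add: right_diff_distrib mult_ac)
          then show ?thesis
            using Suc by (cases k) (simp_all add: w_def fps_X_mult_nth)
        qed (simp add: w_def)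
      qed
    qed simp
    then have "dlog E = of_nat n * (w oo fps_X ^ n)"
      unfolding E_def using assms by (subst dlog_compose_X_power) auto
    also have "\<dots> = factor_dlog n (- monom 1 i)"
      by (rule fps_ext) (use assms in \<open>auto simp: factor_dlog_def w_def fps_nth_compose_X_power
          fps_mult_of_nat_nth monom_power mult.commute elim!: dvdE\<close>)
    finally show ?thesis unfolding P_def by (intro exI[of _ E]) (simp add: E_def)
  qed
  have Pnat: "P (of_nat k * C)" if "P C" for k C
    by (induction k) (auto simp: algebra_simps intro: Padd P0 that)
  have Pmonom': "P (monom c i)" for c i
  proof -
    have *: "monom c i = of_int c * monom 1 i"
      by (simp add: of_int_poly smult_monom)
    show ?thesis
    proof (cases c)
      case (nonneg k)
      then show ?thesis using Pneg[OF Pnat[OF Pmonom, of k i]] * by simp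
    next
      case (neg k)
      then show ?thesis using Pnat[OF Pmonom, of "Suc k" i] *
        by (metis mult_minus_left mult_minus_right of_int_minus of_int_of_nat_eq)
    qed
  qed
  have "P (\<Sum>i\<in>I. monom (coeff C i) i)" for I
    by (induction I rule: infinite_finite_induct) (auto intro: P0 Padd Pmonom')
  then have "P C" using poly_as_sum_of_monoms[of C] by metis
  then show ?thesis by (simp add: P_def)
qed

text \<open>
  A truncated form of the product decomposition of \<open>f\<close>. If the factors of index at most \<open>N\<close>
  have been split off, the logarithmic derivative of the remaining quotient \<open>h\<close> vanishes up to degree
  \<open>N\<close>, so that its next coefficient is \<open>N + 1\<close> times the coefficient of \<open>h\<close>, an
  element of \<open>\<int>[X]\<close> which serves as the next \<open>C\<close>.
\<close>

lemma dlog_factorization: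
  fixes f :: "int poly fps"
  assumes "f $ 0 = 1"
  shows "\<exists>C. \<forall>m. 0 < m \<and> m \<le> N \<longrightarrow>
           dlog f $ m = (\<Sum>n | n dvd m. of_nat n * ev (monom 1 (m div n)) (C n))"
proof (induction N)
  case 0
  then show ?case by auto
next
  case (Suc N)
  then obtain C where C: "\<And>m. 0 < m \<Longrightarrow> m \<le> N \<Longrightarrow>
    dlog f $ m = (\<Sum>n | n dvd m. of_nat n * ev (monom 1 (m div n)) (C n))" by blast
  have "\<forall>n. \<exists>E. n > 0 \<longrightarrow> E $ 0 = 1 \<and> dlog E = factor_dlog n (C n)"
    using ex_factor by blast
  then obtain E where E: "\<And>n. n > 0 \<Longrightarrow> E n $ 0 = 1"
      "\<And>n. n > 0 \<Longrightarrow> dlog (E n) = factor_dlog n (C n)"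
    by metis
  define G where "G = (\<Prod>n\<in>{1..N}. E n)"
  have G0: "G $ 0 = 1" unfolding G_def using E by (intro prod_nth_0) auto
  have dG: "dlog G $ m = (\<Sum>n | n dvd m \<and> n \<le> N. of_nat n * ev (monom 1 (m div n)) (C n))"
    if "m > 0" for m
  proof -
    have "dlog G $ m = (\<Sum>n\<in>{1..N}. factor_dlog n (C n) $ m)"
      unfolding G_def using E by (subst dlog_prod) (auto simp: fps_sum_nth)
    also have "\<dots> = (\<Sum>n | n dvd m \<and> n \<le> N. of_nat n * ev (monom 1 (m div n)) (C n))"
      using that by (intro sum.mono_neutral_cong_right)
        (auto simp: factor_dlog_def intro: Suc_leI dvd_pos_nat)
    finally show ?thesis .
  qed
  define h where "h = f * fps_right_inverse G 1"
  have h0: "h $ 0 = 1" using assms by (simp add: h_def)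
  have dh: "dlog h = dlog f - dlog G"
    unfolding h_def using assms G0 by (simp add: dlog_mult dlog_right_inverse)
  have low: "dlog h $ j = 0" if "j \<le> N" for j
  proof (cases "j = 0")
    case False
    have "{n. n dvd j \<and> n \<le> N} = {n. n dvd j}"
      using that False by (auto dest: dvd_imp_le)
    then show ?thesis using C[of j] dG[of j] that False by (simp add: dh)
  qed simp
  have top: "dlog h $ Suc N = of_nat (Suc N) * h $ Suc N"
  proof -
    have "(dlog h * h) $ Suc N = (\<Sum>i\<le>Suc N. dlog h $ i * h $ (Suc N - i))"
      by (simp only: fps_mult_nth atLeast0AtMost)
    also have "\<dots> = (\<Sum>i\<in>{Suc N}. dlog h $ i * h $ (Suc N - i))"
      by (rule sum.mono_neutral_right) (auto simp: low)
    finally show ?thesis using dlog_mult_self[OF h0] h0 by simp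
  qed
  define C' where "C' = C(Suc N := h $ Suc N)"
  show ?case
  proof (rule exI[of _ C'], intro allI impI)
    fix m assume m: "0 < m \<and> m \<le> Suc N"
    show "dlog f $ m = (\<Sum>n | n dvd m. of_nat n * ev (monom 1 (m div n)) (C' n))"
    proof (cases "m = Suc N")
      case False
      then have "\<And>n. n dvd m \<Longrightarrow> C' n = C n" using m by (auto simp: C'_def dest: dvd_imp_le)
      then show ?thesis using C[of m] m False by simp
    next
      case True
      have "{n. n dvd m} = insert (Suc N) {n. n dvd m \<and> n \<le> N}"
        using m True by (auto dest: dvd_imp_le simp: le_Suc_eq)
      then have "(\<Sum>n | n dvd m. of_nat n * ev (monom 1 (m div n)) (C' n)) =
        of_nat (Suc N) * h $ Suc N + (\<Sum>n | n dvd m \<and> n \<le> N. of_nat n * ev (monom 1 (m div n)) (C' n))"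
        using True by (simp add: C'_def)
      also have "(\<Sum>n | n dvd m \<and> n \<le> N. of_nat n * ev (monom 1 (m div n)) (C' n)) = dlog G $ m"
        using dG[of m] m by (auto simp: C'_def intro!: sum.cong)
      also have "of_nat (Suc N) * h $ Suc N + dlog G $ m = dlog f $ m"
        using top dh True by simp
      finally show ?thesis by simp
    qed
  qed
qed

text \<open>
  Moebius inversion of the previous formula: the sum is \<open>m C_m\<close>. Only the \<open>C_n\<close> with
  \<open>n\<close> dividing \<open>m\<close> enter, so the truncated decomposition with \<open>N = m\<close> suffices.
\<close>

lemma moebius_dlog_dvd:
  fixes f :: "int poly fps"
  assumes "f $ 0 = 1" "m > 0"
  shows "of_nat m dvd
    (\<Sum>d | d dvd m. of_int (moebius_mu d) * ev (monom 1 d) (dlog f $ (m div d)) :: int poly)"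
proof -
  obtain C where C: "\<And>k. 0 < k \<Longrightarrow> k \<le> m \<Longrightarrow>
    dlog f $ k = (\<Sum>n | n dvd k. of_nat n * ev (monom 1 (k div n)) (C n))"
    using dlog_factorization[OF assms(1), of m] by blast
  define T :: "nat \<Rightarrow> int poly" where "T n = of_nat n * ev (monom 1 (m div n)) (C n)" for n
  have fin: "finite {n. n dvd m}" using assms(2) by simp
  have inner: "ev (monom 1 d) (dlog f $ (m div d)) = (\<Sum>n | n dvd m div d. T n)" if "d dvd m" for d
  proof -
    have pos: "0 < m div d" using that assms(2) by (auto elim!: dvdE)
    have assoc: "ev (monom 1 d) (ev (monom 1 (m div d div n)) (C n)) = ev (monom 1 (m div n)) (C n)"
      if n: "n dvd m div d" for n
    proof -
      obtain a where a: "m = d * a" using \<open>d dvd m\<close> by blast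
      then have "a = m div d" using assms(2) by auto
      then obtain e where "a = n * e" using n by blast
      with a have "m = d * (n * e)" by simp
      then show ?thesis using pos assms(2) by (simp add: monom_power mult.commute mult.left_commute)
    qed
    have "ev (monom 1 d) (dlog f $ (m div d)) =
        (\<Sum>n | n dvd m div d. of_nat n * ev (monom 1 d) (ev (monom 1 (m div d div n)) (C n)))"
      by (subst C) (use pos in simp_all)
    also have "\<dots> = (\<Sum>n | n dvd m div d. T n)"
      by (rule sum.cong) (simp_all add: T_def assoc del: ev_ev_monom)
    finally show ?thesis .
  qed
  have "(\<Sum>d | d dvd m. of_int (moebius_mu d) * ev (monom 1 d) (dlog f $ (m div d)))
      = (\<Sum>d | d dvd m. \<Sum>n | n dvd m div d. of_int (moebius_mu d) * T n)"
    by (rule sum.cong) (simp_all add: inner sum_distrib_left)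
  also have "\<dots> = (\<Sum>d | d dvd m. \<Sum>n | n dvd m \<and> n * d dvd m. of_int (moebius_mu d) * T n)"
  proof (rule sum.cong[OF refl])
    fix d assume "d \<in> {d. d dvd m}"
    then obtain e where e: "m = d * e" by auto
    then have "{n. n dvd m div d} = {n. n dvd m \<and> n * d dvd m}"
      using assms(2) by (auto simp: mult.commute[of _ d])
    then show "(\<Sum>n | n dvd m div d. of_int (moebius_mu d) * T n)
        = (\<Sum>n | n dvd m \<and> n * d dvd m. of_int (moebius_mu d) * T n)" by simp
  qed
  also have "\<dots> = (\<Sum>n | n dvd m. \<Sum>d | d dvd m \<and> n * d dvd m. of_int (moebius_mu d) * T n)"
    using sum.swap_restrict[OF fin fin, of "\<lambda>d n. of_int (moebius_mu d) * T n" "\<lambda>d n. n * d dvd m"]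
    by simp
  also have "\<dots> = (\<Sum>n | n dvd m. if n = m then T n else 0)"
  proof (rule sum.cong[OF refl])
    fix n assume n: "n \<in> {n. n dvd m}"
    then obtain e where e: "m = n * e" by auto
    have "{d. d dvd m \<and> n * d dvd m} = {d. d dvd e}" using e assms(2) by auto
    then have "(\<Sum>d | d dvd m \<and> n * d dvd m. of_int (moebius_mu d) * T n)
        = of_int (\<Sum>d | d dvd e. moebius_mu d) * T n"
      by (simp add: sum_distrib_right)
    also have "\<dots> = (if n = m then T n else 0)"
      using e assms(2) by (subst moebius_sum_divisors) auto
    finally show "(\<Sum>d | d dvd m \<and> n * d dvd m. of_int (moebius_mu d) * T n)
        = (if n = m then T n else 0)" .
  qed
  also have "\<dots> = T m" using fin by simp
  finally show ?thesis by (simp only: T_def dvd_triv_left)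
qed

section \<open>Power series defined by a functional equation\<close>

text \<open>
  Each coefficient of the right-hand side of the functional equations below depends only on
  lower coefficients of the unknown series. Such maps are contractions for the adic metric and
  have exactly one fixed point.
\<close>

definition agree :: "nat \<Rightarrow> 'a::zero fps \<Rightarrow> 'a fps \<Rightarrow> bool" where
  "agree n f g \<longleftrightarrow> (\<forall>k<n. f $ k = g $ k)"

definition contraction :: "('a::zero fps \<Rightarrow> 'a fps) \<Rightarrow> bool" where
  "contraction \<Phi> \<longleftrightarrow> (\<forall>n f g. agree n f g \<longrightarrow> agree (Suc n) (\<Phi> f) (\<Phi> g))"

lemma contraction_unique:
  assumes "contraction \<Phi>" "\<Phi> f = f" "\<Phi> g = g"
  shows "f = g"
proof -
  have "agree n f g" for n
  proof (induction n)
    case (Suc n)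
    then show ?case using assms unfolding contraction_def by metis
  qed (simp add: agree_def)
  then show ?thesis by (auto simp: agree_def fps_eq_iff)
qed

lemma contraction_fixpoint:
  assumes "contraction \<Phi>"
  shows "\<exists>f. \<Phi> f = f"
proof -
  define it where "it n = (\<Phi> ^^ n) 0" for n
  have it: "agree n (it n) (it (n + k))" for n k
  proof (induction n)
    case (Suc n)
    then show ?case using assms unfolding contraction_def it_def by simp
  qed (simp add: agree_def)
  define f where "f = Abs_fps (\<lambda>n. it (Suc n) $ n)"
  have f: "agree n f (it n)" for n
    unfolding agree_def
  proof (intro allI impI)
    fix k assume "k < n"
    then show "f $ k = it n $ k"
      using it[of "Suc k" "n - Suc k"] by (simp add: f_def agree_def)
  qed
  have "agree (Suc n) (\<Phi> f) f" for n
    using assms f[of n] f[of "Suc n"] unfolding contraction_def it_def agree_def by simp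
  then show ?thesis by (intro exI[of _ f]) (auto simp: agree_def fps_eq_iff)
qed

lemma agree_refl [simp]: "agree n f f"
  by (simp add: agree_def)

lemma agree_diff: "agree n f g \<Longrightarrow> agree n h k \<Longrightarrow> agree n (f - h) (g - k)"
  for f g h k :: "'a::group_add fps"
  by (simp add: agree_def)

lemma agree_mult: "agree n f g \<Longrightarrow> agree n h k \<Longrightarrow> agree n (f * h) (g * k)"
  by (auto simp: agree_def fps_mult_nth intro!: sum.cong)

lemma agree_prod: "(\<And>x. x \<in> A \<Longrightarrow> agree n (f x) (g x)) \<Longrightarrow> agree n (prod f A) (prod g A)"
  by (induction A rule: infinite_finite_induct) (auto intro: agree_mult)

lemma agree_power: "agree n f g \<Longrightarrow> agree n (f ^ k) (g ^ k)"
  by (induction k) (auto intro: agree_mult)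

lemma agree_X_power_mult:
  fixes f g :: "'a::comm_ring_1 fps"
  shows "agree n f g \<Longrightarrow> r > 0 \<Longrightarrow> agree (Suc n) (fps_X ^ r * f) (fps_X ^ r * g)"
  by (auto simp: agree_def fps_X_power_mult_nth)

text \<open>
  The right-hand side of the equation \<open>V(y) = 1 - (-1) ^ s y V(y) V(p y) \<dots> V(p ^ (s - 1) y)\<close>.
  Composition with \<open>fps_const c * fps_X\<close> is the dilation \<open>y \<mapsto> c y\<close>.
\<close>

definition q_step :: "nat \<Rightarrow> 'a::idom \<Rightarrow> 'a fps \<Rightarrow> 'a fps" where
  "q_step s p U = 1 - (-1) ^ s * (fps_X * (\<Prod>i<s. U oo (fps_const (p ^ i) * fps_X)))"

lemma contraction_q_step: "contraction (q_step s p)"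
  unfolding contraction_def
proof (intro allI impI)
  fix n and f g :: "'a fps"
  assume "agree n f g"
  then have "agree n (f oo (fps_const c * fps_X)) (g oo (fps_const c * fps_X))" for c
    by (simp add: agree_def)
  then have "agree (Suc n) (fps_X ^ 1 * (\<Prod>i<s. f oo (fps_const (p ^ i) * fps_X)))
      (fps_X ^ 1 * (\<Prod>i<s. g oo (fps_const (p ^ i) * fps_X)))"
    by (intro agree_X_power_mult agree_prod) auto
  then show "agree (Suc n) (q_step s p f) (q_step s p g)"
    unfolding q_step_def power_one_right by (intro agree_diff agree_mult[of _ "(-1) ^ s"] agree_refl)
qed

text \<open>
  The solution over \<open>\<int>[X]\<close> with \<open>p = X\<close>; the solution for any other parameter is a
  specialization of it.
\<close>

definition q_fix :: "nat \<Rightarrow> int poly fps" where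
  "q_fix s = (SOME U. q_step s (monom 1 1) U = U)"

lemma q_step_q_fix: "q_step s (monom 1 1) (q_fix s) = q_fix s"
  unfolding q_fix_def using contraction_fixpoint[OF contraction_q_step] by (rule someI_ex)

lemma fps_ev_dilate:
  "fps_ev a (F oo (fps_const c * fps_X)) = fps_ev a F oo (fps_const (ev a c) * fps_X)"
  for a :: "'a::idom"
  by (rule fps_ext) simp

lemma q_step_fps_ev: "q_step s a (fps_ev a (q_fix s)) = fps_ev a (q_fix s)"
proof -
  have "fps_ev a (q_fix s) = fps_ev a (q_step s (monom 1 1) (q_fix s))"
    by (simp only: q_step_q_fix)
  also have "\<dots> = q_step s a (fps_ev a (q_fix s))"
    by (simp add: q_step_def fps_ev_dilate)
  finally show ?thesis by simp
qed

lemma q_fix_unique: "q_step s a U = U \<Longrightarrow> U = fps_ev a (q_fix s)"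
  using contraction_unique[OF contraction_q_step] q_step_fps_ev by metis

lemma q_fix_nth_0 [simp]: "q_fix s $ 0 = 1"
  by (subst q_step_q_fix[symmetric]) (simp add: q_step_def)

section \<open>Specialization at roots of unity\<close>

text \<open>
  The Gaussian binomial coefficients, defined by their Pascal recursion so that \<open>z\<close> may be a root of
  unity.
\<close>

fun qbinom :: "'a::comm_ring_1 \<Rightarrow> nat \<Rightarrow> nat \<Rightarrow> 'a" where
  "qbinom z n 0 = 1"
| "qbinom z 0 (Suc j) = 0"
| "qbinom z (Suc n) (Suc j) = z ^ Suc j * qbinom z n (Suc j) + qbinom z n j"

lemma qbinom_eq_0: "n < j \<Longrightarrow> qbinom z n j = 0"
  by (induction z n j rule: qbinom.induct) auto

lemma qbinom_self [simp]: "qbinom z n n = 1"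
  by (induction n) (simp_all add: qbinom_eq_0)

text \<open>
  The analogue of \<open>(j + 1) binom(n + 1, j + 1) = (n + 1) binom(n, j)\<close>. The induction uses
  the identity for \<open>n\<close> at both \<open>j\<close> and \<open>j - 1\<close>.
\<close>

lemma qbinom_absorb:
  "(1 - z ^ Suc j) * qbinom z (Suc n) (Suc j) = (1 - z ^ Suc n) * qbinom z n j"
proof (induction n arbitrary: j)
  case 0
  then show ?case by (cases j) simp_all
next
  case (Suc n)
  have lower: "(1 - z ^ Suc n) * (qbinom z (Suc n) j - z ^ j * qbinom z n j)
      = (1 - z ^ j) * qbinom z (Suc n) j"
    by (cases j) (use Suc.IH in simp_all)
  have "(1 - z ^ Suc j) * qbinom z (Suc (Suc n)) (Suc j)
      = z ^ Suc j * ((1 - z ^ Suc j) * qbinom z (Suc n) (Suc j)) + (1 - z ^ Suc j) * qbinom z (Suc n) j"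
    by (simp add: algebra_simps)
  also have "\<dots> = z * ((1 - z ^ Suc n) * (z ^ j * qbinom z n j)) + (1 - z ^ Suc j) * qbinom z (Suc n) j"
    by (simp only: Suc.IH) (simp add: algebra_simps)
  also have "(1 - z ^ Suc n) * (z ^ j * qbinom z n j)
      = (1 - z ^ Suc n) * qbinom z (Suc n) j - (1 - z ^ j) * qbinom z (Suc n) j"
    using lower by (simp add: algebra_simps)
  finally show ?case by (simp add: algebra_simps)
qed

definition primitive_root_of_unity :: "nat \<Rightarrow> 'a::idom \<Rightarrow> bool" where
  "primitive_root_of_unity r z \<longleftrightarrow> r > 0 \<and> (\<forall>n. z ^ n = 1 \<longleftrightarrow> r dvd n)"

lemma ex_primitive_root_of_unity:
  assumes "z ^ m = 1" "m > 0"
  obtains r where "primitive_root_of_unity r z"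
proof -
  define r where "r = (LEAST n. n > 0 \<and> z ^ n = 1)"
  have r: "r > 0" "z ^ r = 1"
    using LeastI[of "\<lambda>n. n > 0 \<and> z ^ n = 1" m] assms by (auto simp: r_def)
  have min: "z ^ n \<noteq> 1" if "0 < n" "n < r" for n
    using not_less_Least[of n "\<lambda>n. n > 0 \<and> z ^ n = 1"] that by (auto simp: r_def)
  have "z ^ n = 1 \<longleftrightarrow> r dvd n" for n
  proof -
    have "z ^ n = (z ^ r) ^ (n div r) * z ^ (n mod r)"
      by (simp flip: power_mult power_add)
    then have "z ^ n = z ^ (n mod r)" using r by simp
    then show ?thesis
      using min[of "n mod r"] r by (cases "n mod r = 0") (auto simp: mod_eq_0_iff_dvd dvd_imp_mod_0)
  qed
  then show ?thesis using r that by (auto simp: primitive_root_of_unity_def)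
qed

lemma qbinom_root_of_unity:
  assumes "primitive_root_of_unity r z" "0 < j" "j < r"
  shows "qbinom z r j = 0"
proof -
  obtain i n where "j = Suc i" "r = Suc n" using assms(2,3) by (cases j; cases r) auto
  moreover have "z ^ r = 1" "z ^ j \<noteq> 1"
    using assms by (auto simp: primitive_root_of_unity_def dest: dvd_imp_le)
  ultimately show ?thesis using qbinom_absorb[of z i n] by simp
qed

text \<open>
  The product of \<open>z ^ 0, \<dots>, z ^ (r - 1)\<close>. For even \<open>r\<close> it comes down to
  \<open>z ^ (r/2) = -1\<close>.
\<close>

lemma root_of_unity_choose_2:
  assumes "primitive_root_of_unity r z"
  shows "z ^ (r choose 2) = (-1) ^ (r - 1)"
proof (cases "even r")
  case True
  then obtain k where k: "r = 2 * k" by auto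
  then have "k > 0" using assms by (auto simp: primitive_root_of_unity_def)
  then have "z ^ k \<noteq> 1" "(z ^ k)\<^sup>2 = 1"
    using assms k by (auto simp: primitive_root_of_unity_def mult.commute simp flip: power_mult dest: dvd_imp_le)
  then have "z ^ k = -1" by (simp add: power2_eq_1_iff)
  moreover have "r choose 2 = k * (r - 1)" using k by (simp add: choose_two)
  ultimately show ?thesis by (simp add: power_mult)
next
  case False
  then obtain k where k: "r = Suc (2 * k)" by (auto elim: oddE)
  then have "r choose 2 = r * k" by (simp add: choose_two)
  then have "z ^ (r choose 2) = (z ^ r) ^ k" by (simp only: power_mult)
  also have "z ^ r = 1" using assms by (simp add: primitive_root_of_unity_def)
  finally show ?thesis using k by simp
qed

lemma dilate_dilate:
  fixes F :: "'a::idom fps"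
  shows "(F oo (fps_const c * fps_X)) oo (fps_const d * fps_X) = F oo (fps_const (c * d) * fps_X)"
  by (rule fps_ext) (simp only: fps_nth_compose_linear power_mult_distrib mult.assoc mult.left_commute)

lemma fps_const_mult_X_compose:
  "(fps_const c * (fps_X * F)) oo (fps_const d * fps_X)
     = fps_const c * (fps_const d * fps_X * (F oo (fps_const d * fps_X)))"
  for F :: "'a::idom fps"
  by (rule fps_ext) (auto simp: fps_X_mult_nth mult.assoc gr0_conv_Suc)

text \<open>
  With \<open>g i = V(y) V(z y) \<dots> V(z ^ (i - 1) y)\<close>, the functional equation at \<open>z ^ i y\<close>, multiplied by \<open>g i\<close>,
  becomes the linear recursion \<open>g i = g (i + 1) + (-1) ^ s y z ^ i g (i + s)\<close>, that is,
  \<open>g = (A + B) g\<close> with the shift \<open>A\<close> and a weighted shift \<open>B\<close> satisfying \<open>A B = z B A\<close>.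
  Expanding \<open>g = (A + B) ^ r g\<close> by the q-binomial theorem leaves only \<open>A ^ r\<close> and \<open>B ^ r\<close>, and
  since \<open>g (k r) = (g r) ^ k\<close>, the entry at 0 reads
  \<open>1 = g r + (-1) ^ s y ^ r (g r) ^ s\<close>. The series \<open>V_1(y ^ r)\<close> satisfies the same equation.
\<close>

lemma prod_dilates_root_of_unity:
  fixes z :: "'a::idom"
  assumes z: "primitive_root_of_unity r z"
  shows "(\<Prod>j<r. fps_ev z (q_fix s) oo (fps_const (z ^ j) * fps_X)) = fps_ev 1 (q_fix s) oo fps_X ^ r"
proof -
  define e :: "'a fps" where "e = (-1) ^ s * fps_X"
  define U where "U i = fps_ev z (q_fix s) oo (fps_const (z ^ i) * fps_X)" for i
  define g where "g i = (\<Prod>j<i. U j)" for i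
  have r: "r > 0" "z ^ r = 1" using z by (auto simp: primitive_root_of_unity_def)
  have U_eq: "U i = 1 - fps_const (z ^ i) * (e * (\<Prod>j<s. U (i + j)))" for i
  proof -
    have sgn: "(-1) ^ s * F = fps_const ((-1) ^ s) * F" for F :: "'a fps"
      by (simp flip: fps_const_power fps_const_neg)
    have shift: "fps_ev z (q_fix s) oo (fps_const (z ^ j * z ^ i) * fps_X) = U (i + j)" for j
      by (simp only: U_def power_add mult.commute[of "z ^ i"])
    have "U i = q_step s z (fps_ev z (q_fix s)) oo (fps_const (z ^ i) * fps_X)"
      by (simp only: U_def q_step_fps_ev)
    also have "\<dots> = 1 - fps_const ((-1) ^ s) * (fps_const (z ^ i) * fps_X *
        (\<Prod>j<s. U (i + j)))"
      by (simp add: q_step_def sgn fps_compose_sub_distrib fps_const_mult_X_compose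
        fps_compose_prod_distrib dilate_dilate shift
        del: fps_const_power fps_const_neg fps_const_mult)
    also have "\<dots> = 1 - fps_const (z ^ i) * (e * (\<Prod>j<s. U (i + j)))"
      by (simp add: e_def sgn mult_ac del: fps_const_power fps_const_neg)
    finally show ?thesis .
  qed
  have g_add: "g (i + k) = g i * (\<Prod>j<k. U (i + j))" for i k
    by (induction k) (simp_all add: g_def mult.assoc)
  \<comment> \<open>The functional equation of \<open>V\<close> has become linear.\<close>
  have g_step: "g i = g (Suc i) + fps_const (z ^ i) * (e * g (i + s))" for i
  proof -
    have "g (Suc i) = g i * U i" by (simp add: g_def)
    also have "\<dots> = g i - fps_const (z ^ i) * (e * g (i + s))"
      by (subst U_eq) (simp add: g_add algebra_simps)
    finally show ?thesis by simp
  qed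
  define c where "c n i j = qbinom z n j * z ^ (i * j + s * (j choose 2))" for n i j
  define t where "t n i j = fps_const (c n i j) * (e ^ j * g (i + s * j + (n - j)))" for n i j
  \<comment> \<open>The expansion of \<open>(A + B) ^ n\<close> applied to \<open>g\<close>.\<close>
  have iter: "g i = (\<Sum>j\<le>n. t n i j)" for n i
  proof (induction n arbitrary: i)
    case 0
    then show ?case by (simp add: t_def c_def binomial_eq_0)
  next
    case (Suc n)
    define a where "a j = fps_const (z ^ j * c n i j) * (e ^ j * g (i + s * j + (Suc n - j)))" for j
    have a: "t n (Suc i) j = a j" if "j \<le> n" for j
      using that by (simp add: t_def a_def c_def Suc_diff_le power_add mult_ac)
    \<comment> \<open>The sum over the \<open>a j\<close> may be extended to \<open>Suc n\<close>, which allows an index shift.\<close>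
    have a_last: "a (Suc n) = 0" by (simp add: a_def c_def qbinom_eq_0)
    have b: "t (Suc n) i (Suc j) = a (Suc j) + fps_const (z ^ i) * (e * t n (i + s) j)" for j
    proof -
      have "c (Suc n) i (Suc j) = z ^ Suc j * c n i (Suc j) + z ^ i * c n (i + s) j"
        by (simp add: c_def numeral_2_eq_2 power_add algebra_simps)
      then show ?thesis
        by (simp add: t_def a_def algebra_simps flip: fps_const_add fps_const_mult)
    qed
    have "g i = (\<Sum>j\<le>n. a j) + fps_const (z ^ i) * (e * (\<Sum>j\<le>n. t n (i + s) j))"
      using g_step[of i] Suc.IH[of "Suc i"] Suc.IH[of "i + s"] a by simp
    also have "(\<Sum>j\<le>n. a j) = a 0 + (\<Sum>j\<le>n. a (Suc j))"
      using a_last sum.atMost_Suc[of a n] sum.atMost_Suc_shift[of a n] by simp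
    also have "a 0 = t (Suc n) i 0" by (simp add: a_def t_def c_def)
    also have "t (Suc n) i 0 + (\<Sum>j\<le>n. a (Suc j)) + fps_const (z ^ i) * (e * (\<Sum>j\<le>n. t n (i + s) j))
        = t (Suc n) i 0 + (\<Sum>j\<le>n. t (Suc n) i (Suc j))"
      by (simp add: b sum.distrib sum_distrib_left)
    finally show ?case by (simp only: sum.atMost_Suc_shift)
  qed
  have U_periodic: "U (i + r) = U i" for i using r by (simp add: U_def power_add)
  have g_periodic: "g (k * r) = g r ^ k" for k
  proof (induction k)
    case (Suc k)
    have "g (r + k * r) = g r * (\<Prod>j<k * r. U (r + j))" by (rule g_add)
    also have "(\<Prod>j<k * r. U (r + j)) = g (k * r)"
      using U_periodic by (simp add: g_def add.commute)
    finally show ?case using Suc by simp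
  qed (simp add: g_def)
  have "1 = (\<Sum>j\<le>r. t r 0 j)" using iter[of 0 r] by (simp add: g_def)
  also have "\<dots> = (\<Sum>j\<in>{0, r}. t r 0 j)"
  proof (rule sum.mono_neutral_right)
    show "\<forall>j\<in>{..r} - {0, r}. t r 0 j = 0"
      using qbinom_root_of_unity[OF z] by (auto simp: t_def c_def)
  qed auto
  also have "\<dots> = g r + fps_const (((-1) ^ (r - 1)) ^ s) * (e ^ r * g r ^ s)"
    using r root_of_unity_choose_2[OF z] g_periodic[of s]
    by (simp add: t_def c_def power_mult mult.commute[of s] numeral_2_eq_2)
  also have "fps_const (((-1) ^ (r - 1)) ^ s) * (e ^ r * g r ^ s) = (-1) ^ s * (fps_X ^ r * g r ^ s)"
  proof -
    have sign: "fps_const (((-1) ^ (r - 1)) ^ s) = (((-1) ^ (r - 1)) ^ s :: 'a fps)"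
      by (simp flip: fps_const_power fps_const_neg)
    have "fps_const (((-1) ^ (r - 1)) ^ s) * ((-1) ^ s) ^ r = ((-1) ^ (s * (r - 1)) * (-1) ^ (s * r) :: 'a fps)"
      by (simp only: sign mult.commute[of s "r - 1"] power_mult)
    also have "\<dots> = (-1) ^ (s * (r - 1) + s * r)" by (simp add: power_add)
    also have "\<dots> = (-1) ^ s" using r by (auto simp: minus_one_power_iff)
    finally show ?thesis by (simp add: e_def power_mult_distrib mult.assoc[symmetric])
  qed
  finally have gr: "g r = 1 - (-1) ^ s * (fps_X ^ r * g r ^ s)" by (simp add: algebra_simps)
  \<comment> \<open>Both sides of the claim are fixed points of the following contraction.\<close>
  define \<Phi> :: "'a fps \<Rightarrow> 'a fps" where "\<Phi> W = 1 - (-1) ^ s * (fps_X ^ r * W ^ s)" for W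
  have contr: "contraction \<Phi>"
    unfolding contraction_def
  proof (intro allI impI)
    fix n and f h :: "'a fps"
    assume "agree n f h"
    then have "agree (Suc n) (fps_X ^ r * f ^ s) (fps_X ^ r * h ^ s)"
      using r by (intro agree_X_power_mult agree_power)
    then show "agree (Suc n) (\<Phi> f) (\<Phi> h)"
      unfolding \<Phi>_def by (intro agree_diff agree_mult[of _ "(-1) ^ s"] agree_refl)
  qed
  define W where "W = fps_ev (1::'a) (q_fix s)"
  have sign: "((-1) ^ s :: 'a fps) oo fps_X ^ r = (-1) ^ s"
    using r by (simp add: fps_compose_uminus flip: fps_compose_power)
  have "W = 1 - (-1) ^ s * (fps_X * W ^ s)"
    using q_step_fps_ev[of s "1::'a"] by (simp add: q_step_def W_def)
  then have "W oo fps_X ^ r = (1 - (-1) ^ s * (fps_X * W ^ s)) oo fps_X ^ r" by simp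
  also have "\<dots> = \<Phi> (W oo fps_X ^ r)"
    using r by (simp add: \<Phi>_def fps_compose_sub_distrib fps_compose_mult_distrib fps_compose_power
      fps_compose_uminus sign)
  finally have "\<Phi> (W oo fps_X ^ r) = W oo fps_X ^ r" by simp
  moreover have "\<Phi> (g r) = g r" using gr by (simp add: \<Phi>_def)
  ultimately have "g r = W oo fps_X ^ r" using contraction_unique[OF contr] by blast
  then show ?thesis by (simp add: g_def U_def W_def)
qed

text \<open>
  Compare the coefficients of \<open>y ^ (r k)\<close> in the logarithmic derivatives of the preceding
  identity: all \<open>r\<close> dilates contribute the same term on the left, and the substitution of \<open>y ^ r\<close> produces the
  factor \<open>r\<close> on the right.
\<close>

lemma dlog_q_fix_root_of_unity:
  fixes z :: "'a::field_char_0"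
  assumes z: "primitive_root_of_unity r z"
  shows "ev z (dlog (q_fix s) $ (r * k)) = ev 1 (dlog (q_fix s) $ k)"
proof -
  have r: "r > 0" "z ^ r = 1" using z by (auto simp: primitive_root_of_unity_def)
  have "(\<Sum>j<r. dlog (fps_ev z (q_fix s)) oo (fps_const (z ^ j) * fps_X))
      = dlog (\<Prod>j<r. fps_ev z (q_fix s) oo (fps_const (z ^ j) * fps_X))"
    by (subst dlog_prod) (simp_all add: dlog_dilate)
  also have "\<dots> = of_nat r * (dlog (fps_ev 1 (q_fix s)) oo fps_X ^ r)"
    using r by (simp add: prod_dilates_root_of_unity[OF z] dlog_compose_X_power)
  finally have "(\<Sum>j<r. (z ^ j) ^ (r * k) * ev z (dlog (q_fix s) $ (r * k)))
      = of_nat r * ev 1 (dlog (q_fix s) $ k)"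
    using r by (simp add: fps_eq_iff dlog_fps_ev fps_sum_nth fps_mult_of_nat_nth fps_nth_compose_X_power)
  moreover have "(z ^ j) ^ (r * k) = 1" for j
    using r by (metis mult.commute power_mult power_one)
  ultimately show ?thesis using r by simp
qed

text \<open>
  Both sides equal \<open>w_{n/r}(1)\<close>, because \<open>z ^ l\<close> has order \<open>r / l\<close>.
\<close>

lemma dlog_q_fix_prime_descent:
  fixes z :: "'a::field_char_0"
  assumes z: "primitive_root_of_unity r z" and "prime l" "l dvd r" "r dvd n"
  shows "ev (z ^ l) (dlog (q_fix s) $ (n div l)) = ev z (dlog (q_fix s) $ n)"
proof -
  have l: "l > 0" using assms(2) by (simp add: prime_gt_0_nat)
  obtain r' where r': "r = l * r'" using assms(3) by blast
  obtain k where k: "n = r * k" using assms(4) by blast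
  have "primitive_root_of_unity r' (z ^ l)"
    using z l unfolding primitive_root_of_unity_def r' by (auto simp flip: power_mult)
  from dlog_q_fix_root_of_unity[OF this, of s k] dlog_q_fix_root_of_unity[OF z, of s k]
  show ?thesis using l by (simp add: k r' mult.assoc)
qed

definition dlog_moebius :: "nat \<Rightarrow> nat \<Rightarrow> int poly" where
  "dlog_moebius s m =
     (\<Sum>d | d dvd m. of_int (moebius_mu d) * ev (monom 1 d) (dlog (q_fix s) $ (m div d)))"

text \<open>
  For a prime \<open>l\<close> dividing the order of \<open>z\<close> and \<open>d\<close> prime to \<open>l\<close>, the order of \<open>z ^ d\<close> is still
  divisible by \<open>l\<close>. Hence the terms at \<open>d\<close> and \<open>l d\<close> have the same value
  apart from the Moebius factor.
\<close>

lemma dlog_moebius_root_of_unity: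
  fixes z :: "'a::field_char_0"
  assumes "z ^ m = 1" "z \<noteq> 1" "m > 0"
  shows "ev z (dlog_moebius s m) = 0"
proof -
  obtain r where r: "primitive_root_of_unity r z"
    using ex_primitive_root_of_unity assms by blast
  then have "r \<noteq> 1" "r dvd m"
    using assms by (auto simp: primitive_root_of_unity_def) (metis power_one_right)
  then obtain l where l: "prime l" "l dvd r" using prime_factor_nat by blast
  have "(\<Sum>d | d dvd m. of_int (moebius_mu d) * ev (z ^ d) (dlog (q_fix s) $ (m div d))) = 0"
  proof (rule moebius_sum_eq_0[OF assms(3) l(1)])
    show "l dvd m" using l(2) \<open>r dvd m\<close> by (rule dvd_trans)
    fix d assume d: "\<not> l dvd d" "l * d dvd m"
    then obtain k where k: "m = l * d * k" by blast
    have pos: "l > 0" "d > 0" using k assms(3) by auto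
    have 1: "(z ^ d) ^ (l * k) = 1" using assms(1) k by (simp add: mult_ac flip: power_mult)
    obtain r' where r': "primitive_root_of_unity r' (z ^ d)"
      using ex_primitive_root_of_unity[OF 1] k assms(3) by auto
    then have "z ^ (d * r') = 1" by (simp add: primitive_root_of_unity_def power_mult)
    then have "l dvd d * r'" using r l(2) by (auto simp: primitive_root_of_unity_def intro: dvd_trans)
    then have "l dvd r'" using d(1) l(1) by (simp add: prime_dvd_mult_iff)
    moreover have "r' dvd l * k" using r' 1 by (simp add: primitive_root_of_unity_def)
    ultimately have "ev ((z ^ d) ^ l) (dlog (q_fix s) $ (l * k div l)) = ev (z ^ d) (dlog (q_fix s) $ (l * k))"
      by (intro dlog_q_fix_prime_descent[OF r' l(1)])
    moreover have "m div (l * d) = k" "m div d = l * k" using k pos by simp_all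
    ultimately show "ev (z ^ (l * d)) (dlog (q_fix s) $ (m div (l * d))) = ev (z ^ d) (dlog (q_fix s) $ (m div d))"
      using pos by (simp add: power_mult mult.commute[of l])
  qed
  then show ?thesis by (simp add: dlog_moebius_def)
qed

text \<open>
  Division by the monic polynomial \<open>1 + X + \<dots> + X ^ (m - 1)\<close> is possible over the integers,
  and the remainder has degree less than \<open>m - 1\<close> but \<open>m - 1\<close> complex zeros.
\<close>

lemma dvd_int_poly_roots_of_unity:
  fixes S :: "int poly"
  assumes "m > 0" and S: "\<And>z::complex. z ^ m = 1 \<Longrightarrow> z \<noteq> 1 \<Longrightarrow> ev z S = 0"
  shows "(\<Sum>i<m. monom 1 i) dvd S"
proof -
  define Q :: "int poly" where "Q = (\<Sum>i<m. monom 1 i)"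
  have coeff_Q: "coeff Q i = (if i < m then 1 else 0)" for i
    by (simp add: Q_def coeff_sum)
  have deg: "degree Q = m - 1"
    by (rule antisym[OF degree_le le_degree]) (use assms(1) in \<open>auto simp: coeff_Q\<close>)
  have lc: "lead_coeff Q = 1" using assms(1) by (simp add: deg coeff_Q)
  then have "Q \<noteq> 0" by auto
  obtain D R where DR: "pseudo_divmod S Q = (D, R)" by (cases "pseudo_divmod S Q")
  from pseudo_divmod[OF \<open>Q \<noteq> 0\<close> DR] lc have S_eq: "S = Q * D + R" and R: "R = 0 \<or> degree R < m - 1"
    by (auto simp: deg)
  have "R = 0"
  proof (rule ccontr)
    assume "R \<noteq> 0"
    define P :: "complex poly" where "P = map_poly of_int R"
    have "P \<noteq> 0" "degree P = degree R"
      using \<open>R \<noteq> 0\<close> by (auto simp: P_def poly_eq_iff coeff_map_poly degree_map_poly)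
    have "{z. z ^ m = 1} - {1} \<subseteq> {z. poly P z = 0}"
    proof
      fix z :: complex assume z: "z \<in> {z. z ^ m = 1} - {1}"
      have "(z - 1) * ev z Q = z ^ m - 1" by (simp add: Q_def power_diff_1_eq)
      then have "ev z Q = 0" using z by simp
      then have "ev z R = 0" using S[of z] z by (simp add: S_eq)
      then show "z \<in> {z. poly P z = 0}" by (simp add: ev_def P_def)
    qed
    then have "card ({z::complex. z ^ m = 1} - {1}) \<le> card {z. poly P z = 0}"
      using poly_roots_finite[OF \<open>P \<noteq> 0\<close>] by (rule card_mono[rotated])
    also have "\<dots> \<le> degree P" using \<open>P \<noteq> 0\<close> by (intro card_poly_roots_bound) simp
    finally have "m - 1 \<le> degree R"
      using card_roots_unity_eq[OF assms(1)] assms(1) \<open>degree P = degree R\<close>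
      by (simp add: card_Diff_singleton)
    then show False using R \<open>R \<noteq> 0\<close> by simp
  qed
  then show ?thesis using S_eq by (simp add: Q_def)
qed

text \<open>
  Dividing by \<open>m\<close> first does not affect the zeros, so both divisibilities hold simultaneously.
\<close>

lemma dlog_moebius_factor:
  assumes "m > 0"
  obtains D where "dlog_moebius s m = of_nat m * ((\<Sum>i<m. monom 1 i) * D)"
proof -
  obtain C where C: "dlog_moebius s m = of_nat m * C"
    using moebius_dlog_dvd[of "q_fix s" m] assms unfolding dlog_moebius_def by auto
  have "ev z C = 0" if "z ^ m = 1" "z \<noteq> 1" for z :: complex
    using dlog_moebius_root_of_unity[OF that assms, of s] C assms by simp
  then have "(\<Sum>i<m. monom 1 i) dvd C" using assms by (intro dvd_int_poly_roots_of_unity)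
  then show ?thesis using C that by (auto elim!: dvdE)
qed

section \<open>The substitution \<open>t \<mapsto> t ^ d\<close>\<close>

lemma subst_qhalf_0 [simp]: "d > 0 \<Longrightarrow> subst_qhalf d 0 = 0"
  and subst_qhalf_1 [simp]: "d > 0 \<Longrightarrow> subst_qhalf d 1 = 1"
  by (simp_all add: Zero_fract_def One_fract_def subst_qhalf_Fract pcompose_1)

lemma pcompose_monom_eq_0: "d > 0 \<Longrightarrow> p \<circ>\<^sub>p monom 1 d = 0 \<longleftrightarrow> p = 0" for p :: "rat poly"
  by (simp add: pcompose_eq_0_iff degree_monom_eq)

lemma subst_qhalf_add [simp]:
  assumes "d > 0"
  shows "subst_qhalf d (x + y) = subst_qhalf d x + subst_qhalf d y"
proof -
  obtain a b where x: "x = Fraction_Field.Fract a b" "b \<noteq> 0" by (cases x)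
  obtain a' b' where y: "y = Fraction_Field.Fract a' b'" "b' \<noteq> 0" by (cases y)
  show ?thesis using assms x y
    by (simp add: subst_qhalf_Fract pcompose_monom_eq_0 pcompose_add pcompose_mult)
qed

lemma subst_qhalf_mult [simp]:
  assumes "d > 0"
  shows "subst_qhalf d (x * y) = subst_qhalf d x * subst_qhalf d y"
proof -
  obtain a b where x: "x = Fraction_Field.Fract a b" "b \<noteq> 0" by (cases x)
  obtain a' b' where y: "y = Fraction_Field.Fract a' b'" "b' \<noteq> 0" by (cases y)
  show ?thesis using assms x y
    by (simp add: subst_qhalf_Fract pcompose_mult)
qed

lemma subst_qhalf_minus [simp]: "d > 0 \<Longrightarrow> subst_qhalf d (- x) = - subst_qhalf d x"
  using subst_qhalf_add[of d x "- x"] by (simp add: eq_neg_iff_add_eq_0 add.commute)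

lemma subst_qhalf_diff [simp]: "d > 0 \<Longrightarrow> subst_qhalf d (x - y) = subst_qhalf d x - subst_qhalf d y"
  using subst_qhalf_add[of d x "- y"] by simp

lemma subst_qhalf_inverse [simp]:
  assumes "d > 0"
  shows "subst_qhalf d (inverse x) = inverse (subst_qhalf d x)"
proof (cases "x = 0")
  case False
  then have "subst_qhalf d x * subst_qhalf d (inverse x) = 1"
    using assms by (simp flip: subst_qhalf_mult)
  then show ?thesis by (simp add: inverse_unique)
qed (use assms in simp)

lemma subst_qhalf_divide [simp]:
  "d > 0 \<Longrightarrow> subst_qhalf d (x / y) = subst_qhalf d x / subst_qhalf d y"
  by (simp add: divide_inverse)

lemma subst_qhalf_power [simp]: "d > 0 \<Longrightarrow> subst_qhalf d (x ^ n) = subst_qhalf d x ^ n"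
  by (induction n) simp_all

lemma subst_qhalf_of_nat [simp]: "d > 0 \<Longrightarrow> subst_qhalf d (of_nat n) = of_nat n"
  by (induction n) simp_all

lemma subst_qhalf_of_int [simp]: "d > 0 \<Longrightarrow> subst_qhalf d (of_int n) = of_int n"
  by (cases n rule: int_cases2) simp_all

lemma subst_qhalf_ev [simp]: "d > 0 \<Longrightarrow> subst_qhalf d (ev x f) = ev (subst_qhalf d x) f"
  by (induction f) (simp_all add: ev_pCons)

lemma qhalf_power: "qhalf ^ n = Fraction_Field.Fract (monom 1 n) 1"
  by (induction n) (simp_all add: qhalf_def to_fract_def One_fract_def monom_Suc)

lemma subst_qhalf_qhalf [simp]: "d > 0 \<Longrightarrow> subst_qhalf d qhalf = qhalf ^ d"
  unfolding qhalf_power using subst_qhalf_Fract[of d 1 "[:0, 1:]"]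
  by (simp add: qhalf_def to_fract_def pcompose_pCons pcompose_1)

lemma qhalf_nonzero [simp]: "qhalf \<noteq> 0"
  by (simp add: qhalf_def)

lemma qhalf_power_neq_1: "n > 0 \<Longrightarrow> qhalf ^ n \<noteq> 1"
  by (simp add: qhalf_power One_fract_def eq_fract monom_eq_1_iff)

lemma subst_qhalf_qvar [simp]: "d > 0 \<Longrightarrow> subst_qhalf d qvar = qvar ^ d"
  by (simp add: qvar_def mult.commute flip: power_mult)

lemma qvar_nonzero [simp]: "qvar \<noteq> 0"
  by (simp add: qvar_def)

lemma qvar_power_neq_1: "n > 0 \<Longrightarrow> 1 - qvar ^ n \<noteq> 0"
  using qhalf_power_neq_1[of "2 * n"] by (simp add: qvar_def flip: power_mult)

section \<open>The functional equation of the generating series\<close>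

lemma fps_log_nth:
  assumes "F $ 0 = 1"
  shows "of_nat n * fps_log F $ n = dlog F $ n"
proof -
  have "fps_deriv (fps_log F) = (inverse (1 + fps_X) oo (F - 1)) * fps_deriv F"
    unfolding fps_log_def using assms by (subst fps_compose_deriv) (simp_all add: fps_ln_deriv)
  also have "inverse (1 + fps_X) oo (F - 1) = inverse ((1 + fps_X) oo (F - 1))"
    using assms by (intro fps_inverse_compose) simp_all
  also have "(1 + fps_X) oo (F - 1) = F"
    using assms by (simp add: fps_compose_add_distrib)
  finally have "fps_deriv (fps_log F) * F = fps_deriv F"
    using inverse_mult_eq_1[of F] assms by (simp add: mult.assoc[symmetric] mult.commute[of _ F])
  then have "dlog F = fps_X * fps_deriv (fps_log F)"
    using assms by (intro dlog_unique) (simp_all add: mult.assoc)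
  then show ?thesis by (simp add: fps_X_mult_nth)
qed

text \<open>
  Passing from \<open>n\<close> to \<open>n + 1\<close> raises the doubled exponent by \<open>1 + 2 n (\<tau> + 1)\<close>, and
  \<open>t ^ (2 n (\<tau> + 1)) = (q p ^ s) ^ n\<close>.
\<close>

lemma gen_series_recurrence:
  "(1 - qvar ^ Suc n) * gen_series (- int s) $ Suc n
     = - ((-1) ^ s * (qhalf * ((qvar * inverse qvar ^ s) ^ n * gen_series (- int s) $ n)))"
proof -
  define P where "P n = (\<Prod>i=1..n. 1 - qvar ^ i)" for n
  define c :: "nat \<Rightarrow> coeff_field" where "c n = (-1) powi (int n * (- int s - 1))" for n
  define b where "b n = qhalf powi (int n * (int n - 1) * - int s + (int n)\<^sup>2)" for n
  have F: "gen_series (- int s) $ n = c n * b n / P n" for n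
    by (simp add: gen_series_def P_def c_def b_def)
  have P: "P (Suc n) = P n * (1 - qvar ^ Suc n)" by (simp add: P_def)
  have nz: "1 - qvar ^ Suc n \<noteq> 0"
    by (rule qvar_power_neq_1) simp
  have c: "c (Suc n) = c n * - ((-1) ^ s)"
  proof -
    have "int (Suc n) * (- int s - 1) = int n * (- int s - 1) + - int (Suc s)"
      by (simp add: algebra_simps)
    then have "c (Suc n) = c n * (-1) powi (- int (Suc s))"
      unfolding c_def by (simp only:) (subst power_int_add, simp_all)
    also have "(-1 :: coeff_field) powi (- int (Suc s)) = - ((-1) ^ s)"
      by (simp only: power_int_minus power_int_of_nat) (simp add: minus_one_power_iff)
    finally show ?thesis .
  qed
  have b: "b (Suc n) = b n * (qhalf * (qvar * inverse qvar ^ s) ^ n)"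
  proof -
    have q: "qvar = qhalf powi 2" by (simp add: qvar_def power_int_def)
    have iq: "inverse qvar = qhalf powi (-2)" by (simp add: qvar_def power_int_def power_inverse)
    have e: "int (Suc n) * (int (Suc n) - 1) * - int s + (int (Suc n))\<^sup>2
        = (int n * (int n - 1) * - int s + (int n)\<^sup>2) + (1 + (2 + (-2) * int s) * int n)"
      by (simp add: algebra_simps power2_eq_square)
    have "(qvar * inverse qvar ^ s) ^ n = (qhalf powi 2 * (qhalf powi (-2)) powi int s) powi int n"
      by (simp only: iq power_int_of_nat) (simp only: q)
    also have "\<dots> = qhalf powi ((2 + (-2) * int s) * int n)"
      by (simp only: power_int_mult power_int_add qhalf_nonzero simp_thms)
    finally have "(qvar * inverse qvar ^ s) ^ n = qhalf powi ((2 + (-2) * int s) * int n)" .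
    then show ?thesis unfolding b_def e by (simp add: power_int_add)
  qed
  have cancel: "(1 - qvar ^ Suc n) * (x / (P n * (1 - qvar ^ Suc n))) = x / P n" for x
    using nz by (simp del: power_Suc)
  show ?thesis unfolding F P c b cancel by (simp add: mult_ac)
qed

text \<open>
  For \<open>V = F / F(q x)\<close> the product \<open>V(x) V(p x) \<dots> V(p ^ (k - 1) x)\<close> telescopes, since each
  numerator is the next denominator. The recurrence for the coefficients of \<open>F\<close> thus becomes
  the functional equation of \<open>q_fix s\<close>, up to the rescaling of \<open>x\<close> by \<open>t\<close>.
\<close>

lemma gen_series_ratio:
  fixes s :: nat
  defines "F \<equiv> gen_series (- int s)"
  shows "F = (fps_ev (inverse qvar) (q_fix s) oo (fps_const qhalf * fps_X)) *
    (F oo (fps_const qvar * fps_X))"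
proof -
  define p where "p = inverse qvar"
  have qp: "qvar * p = 1" by (simp add: p_def qvar_def)
  define dil where "dil c G = G oo (fps_const c * fps_X)" for c :: coeff_field and G
  have dil_mult: "dil c (G * H) = dil c G * dil c H" for c G H
    by (simp add: dil_def fps_compose_mult_distrib)
  have dil_dil: "dil d (dil c G) = dil (c * d) G" for c d G
    by (simp add: dil_def dilate_dilate del: fps_const_mult)
  have F0: "F $ 0 = 1" by (simp add: F_def gen_series_nth_0)
  have Fq0: "dil qvar F $ 0 = 1" by (simp add: dil_def F0)
  define V where "V = F * fps_right_inverse (dil qvar F) 1"
  have V: "V * dil qvar F = F"
    using fps_right_inverse[of "dil qvar F" 1] Fq0 by (simp add: V_def mult.assoc mult.commute)
  have telescope: "(\<Prod>i<k. dil (p ^ i) V) * dil qvar F = dil (qvar * p ^ k) F" for k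
  proof (induction k)
    case (Suc k)
    have "(\<Prod>i<Suc k. dil (p ^ i) V) * dil qvar F
        = dil (p ^ k) V * ((\<Prod>i<k. dil (p ^ i) V) * dil qvar F)" by (simp add: mult_ac)
    also have "\<dots> = dil (p ^ k) (V * dil qvar F)"
      by (simp add: Suc dil_mult dil_dil)
    also have "\<dots> = dil (qvar * p ^ Suc k) F"
      using qp by (simp add: V flip: mult.assoc)
    finally show ?case .
  qed simp
  have "F = dil qvar F - fps_const ((-1) ^ s * qhalf) * (fps_X * dil (qvar * p ^ s) F)"
  proof (rule fps_ext)
    fix n
    show "F $ n = (dil qvar F - fps_const ((-1) ^ s * qhalf) * (fps_X * dil (qvar * p ^ s) F)) $ n"
    proof (cases n)
      case (Suc k)
      have "F $ Suc k = qvar ^ Suc k * F $ Suc k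
          - (-1) ^ s * (qhalf * ((qvar * p ^ s) ^ k * F $ k))"
        using gen_series_recurrence[of k s] by (simp only: F_def p_def) (simp add: algebra_simps)
      then show ?thesis by (simp add: Suc dil_def fps_X_mult_nth mult.assoc)
    qed (simp add: F0 Fq0)
  qed
  then have "V * dil qvar F
      = (1 - fps_const ((-1) ^ s * qhalf) * (fps_X * (\<Prod>i<s. dil (p ^ i) V))) * dil qvar F"
    by (simp add: V telescope[symmetric] algebra_simps)
  moreover have "dil qvar F \<noteq> 0" using Fq0 by auto
  ultimately have V_eq: "V = 1 - fps_const ((-1) ^ s * qhalf) * (fps_X * (\<Prod>i<s. dil (p ^ i) V))"
    using mult_right_cancel by blast
  define U where "U = dil (inverse qhalf) V"
  have "U = dil (inverse qhalf) (1 - fps_const ((-1) ^ s * qhalf) * (fps_X * (\<Prod>i<s. dil (p ^ i) V)))"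
    unfolding U_def by (subst V_eq) simp
  also have "\<dots> = 1 - fps_const ((-1) ^ s * qhalf) *
      (fps_const (inverse qhalf) * fps_X * (\<Prod>i<s. dil (p ^ i * inverse qhalf) V))"
    by (simp add: dil_def fps_compose_sub_distrib fps_const_mult_X_compose
        fps_compose_prod_distrib dilate_dilate del: fps_const_mult fps_const_power fps_const_neg)
  also have "\<dots> = 1 - fps_const ((-1) ^ s) * (fps_X * (\<Prod>i<s. dil (p ^ i) U))"
    by (simp add: U_def dil_dil mult.commute[of _ "inverse qhalf"] flip: mult.assoc)
  also have "\<dots> = q_step s p U"
    by (simp add: q_step_def dil_def flip: fps_const_power fps_const_neg)
  finally have "U = fps_ev p (q_fix s)" by (intro q_fix_unique) simp
  moreover have "dil qhalf U = V" by (simp add: U_def dil_dil) (simp add: dil_def)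
  ultimately have "V = fps_ev p (q_fix s) oo (fps_const qhalf * fps_X)" by (simp add: dil_def)
  then show ?thesis using V by (simp add: dil_def p_def)
qed

text \<open>
  The logarithmic derivative of \<open>F = V(t x) F(q x)\<close> has in degree \<open>n\<close> the contribution \<open>q ^ n\<close>
  times itself from the last factor.
\<close>

lemma gen_series_log_nth:
  assumes "n > 0"
  shows "fps_log (gen_series (- int s)) $ n =
    qhalf ^ n * ev (inverse qvar) (dlog (q_fix s) $ n) / (of_nat n * (1 - qvar ^ n))"
proof -
  define F where "F = gen_series (- int s)"
  have F0: "F $ 0 = 1" by (simp add: F_def gen_series_nth_0)
  have nz: "1 - qvar ^ n \<noteq> 0"
    using assms by (rule qvar_power_neq_1)
  have "dlog F = dlog ((fps_ev (inverse qvar) (q_fix s) oo (fps_const qhalf * fps_X)) *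
    (F oo (fps_const qvar * fps_X)))"
    using gen_series_ratio[of s] by (simp only: F_def)
  also have "\<dots> = (fps_ev (inverse qvar) (dlog (q_fix s)) oo (fps_const qhalf * fps_X)) +
    (dlog F oo (fps_const qvar * fps_X))"
    by (simp add: dlog_mult dlog_dilate dlog_fps_ev F0)
  finally have "dlog F $ n = ((fps_ev (inverse qvar) (dlog (q_fix s)) oo (fps_const qhalf * fps_X)) +
    (dlog F oo (fps_const qvar * fps_X))) $ n" by (rule arg_cong)
  then have "dlog F $ n = qhalf ^ n * ev (inverse qvar) (dlog (q_fix s) $ n) + qvar ^ n * dlog F $ n"
    by simp
  then have "(1 - qvar ^ n) * dlog F $ n = qhalf ^ n * ev (inverse qvar) (dlog (q_fix s) $ n)"
    by (simp add: algebra_simps)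
  then have "fps_log F $ n * (of_nat n * (1 - qvar ^ n))
      = qhalf ^ n * ev (inverse qvar) (dlog (q_fix s) $ n)"
    by (simp add: mult_ac flip: fps_log_nth[OF F0])
  then show ?thesis using nz assms by (simp add: F_def nonzero_eq_divide_eq)
qed

text \<open>
  The substitution \<open>t \<mapsto> t ^ d\<close> maps \<open>t ^ (m/d)\<close> and \<open>1 - q ^ (m/d)\<close> to \<open>t ^ m\<close> and \<open>1 - q ^ m\<close> for every
  divisor \<open>d\<close> of \<open>m\<close>, so that these can be factored out of the plethystic logarithm.
\<close>

lemma pleth_Log_gen_series_nth:
  assumes "m > 0"
  shows "pleth_Log (gen_series (- int s)) $ m =
    qhalf ^ m / (of_nat m * (1 - qvar ^ m)) * ev (inverse qvar) (dlog_moebius s m)"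
proof -
  define L where "L = fps_log (gen_series (- int s))"
  define w where "w d = ev (inverse qvar ^ d) (dlog (q_fix s) $ (m div d))" for d
  define K where "K = qhalf ^ m / (of_nat m * (1 - qvar ^ m))"
  have summand: "of_int (moebius_mu d) / of_nat d * subst_qhalf d (L $ (m div d))
      = K * (of_int (moebius_mu d) * w d)" if "d dvd m" for d
  proof -
    from that obtain e where e: "m = d * e" by blast
    then have pos: "d > 0" "e > 0" using assms by auto
    have "subst_qhalf d (L $ e) = qhalf ^ m * w d / (of_nat e * (1 - qvar ^ m))"
      using pos e unfolding L_def w_def
      by (simp add: gen_series_log_nth power_mult power_inverse)
    then show ?thesis using pos e by (simp add: K_def field_simps)
  qed
  have "pleth_Log (gen_series (- int s)) $ m =
      (\<Sum>d=1..m. of_int (moebius_mu d) / of_nat d * Psi d L $ m)"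
    unfolding L_def by (rule pleth_Log_nth)
  also have "\<dots> = (\<Sum>d | d dvd m. of_int (moebius_mu d) / of_nat d * subst_qhalf d (L $ (m div d)))"
    using assms by (intro sum.mono_neutral_cong_right)
      (auto simp: Psi_nth dvd_imp_le Suc_le_eq intro: dvd_pos_nat)
  also have "\<dots> = K * (\<Sum>d | d dvd m. of_int (moebius_mu d) * w d)"
    unfolding sum_distrib_left by (rule sum.cong) (simp_all only: mem_Collect_eq summand)
  finally show ?thesis by (simp add: K_def dlog_moebius_def w_def)
qed

section \<open>Integrality of the coefficients\<close>

lemma laurent_expansion:
  fixes g :: "int poly" and e :: int
  shows "\<exists>N :: int \<Rightarrow> int. finite {k. N k \<noteq> 0} \<and>
    qhalf powi e * ev (inverse qvar) g = (\<Sum>k | N k \<noteq> 0. of_int (N k) * qhalf powi k)"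
proof -
  define I where "I = {..degree g}"
  define x where "x i = e - 2 * int i" for i
  define N where "N k = (\<Sum>i | i \<in> I \<and> x i = k. coeff g i)" for k
  have supp: "{k. N k \<noteq> 0} \<subseteq> x ` I"
  proof
    fix k assume "k \<in> {k. N k \<noteq> 0}"
    then have "{i. i \<in> I \<and> x i = k} \<noteq> {}" unfolding N_def by fastforce
    then show "k \<in> x ` I" by auto
  qed
  have fin: "finite (x ` I)" by (simp add: I_def)
  have "(\<Sum>k | N k \<noteq> 0. of_int (N k) * qhalf powi k) = (\<Sum>k\<in>x ` I. of_int (N k) * qhalf powi k)"
    using fin supp by (intro sum.mono_neutral_left) auto
  also have "\<dots> = (\<Sum>k\<in>x ` I. \<Sum>i | i \<in> I \<and> x i = k. of_int (coeff g i) * qhalf powi x i)"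
    by (rule sum.cong) (auto simp: N_def sum_distrib_right)
  also have "\<dots> = (\<Sum>i\<in>I. of_int (coeff g i) * qhalf powi x i)"
    using fin by (intro sum.group) (auto simp: I_def)
  also have "\<dots> = (\<Sum>i\<in>I. qhalf powi e * (of_int (coeff g i) * inverse qvar ^ i))"
  proof (rule sum.cong)
    fix i
    have "qhalf powi x i = qhalf powi e * inverse qvar ^ i"
      by (simp add: x_def power_int_diff qvar_def divide_inverse power_inverse power_int_mult)
    then show "of_int (coeff g i) * qhalf powi x i
        = qhalf powi e * (of_int (coeff g i) * inverse qvar ^ i)" by simp
  qed simp
  also have "\<dots> = qhalf powi e * ev (inverse qvar) g"
    by (simp add: ev_eq_sum sum_distrib_left I_def)
  finally show ?thesis using finite_subset[OF supp fin] by (intro exI[of _ N]) simp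
qed

theorem corollary1p3:
  fixes \<tau> :: int and m :: nat
  assumes "\<tau> \<le> 0" and "m \<ge> 1"
  shows "\<exists>N :: int \<Rightarrow> int. finite {k. N k \<noteq> 0} \<and>
           f_tau \<tau> m = (\<Sum>k | N k \<noteq> 0. of_int (N k) * qhalf powi k)"
proof -
  obtain s where \<tau>: "\<tau> = - int s"
    using assms(1) by (metis nonpos_int_cases)
  define p where "p = inverse qvar"
  obtain D where D: "dlog_moebius s m = of_nat m * ((\<Sum>i<m. monom 1 i) * D)"
    using dlog_moebius_factor[of m s] assms(2) by auto
  have q: "qvar \<noteq> 0" "1 - qvar ^ m \<noteq> 0" "1 - qvar \<noteq> 0"
    using qvar_power_neq_1[of m] qvar_power_neq_1[of 1] assms(2) by simp_all
  have "p \<noteq> 1" using q by (auto simp: p_def)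
  have geom: "(\<Sum>i<m. p ^ i) / (1 - qvar ^ m) = - (p ^ m / (1 - p))"
  proof -
    have "(1 - p) * (\<Sum>i<m. p ^ i) = 1 - p ^ m" by (rule one_diff_power_eq[symmetric])
    moreover have "1 - p ^ m = - (p ^ m * (1 - qvar ^ m))"
      using q by (simp add: p_def algebra_simps flip: power_mult_distrib)
    ultimately show ?thesis using q \<open>p \<noteq> 1\<close> by (simp add: field_simps)
  qed
  have "f_tau \<tau> m = (qhalf - inverse qhalf) * qhalf ^ m *
      ((\<Sum>i<m. p ^ i) / (1 - qvar ^ m)) * ev p D"
    using assms(2) by (simp add: f_tau_def \<tau> pleth_Log_gen_series_nth D p_def[symmetric])
  also have "qhalf - inverse qhalf = qhalf * (1 - p)"
    by (simp add: p_def qvar_def field_simps power2_eq_square)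
  also have "qhalf * (1 - p) * qhalf ^ m * ((\<Sum>i<m. p ^ i) / (1 - qvar ^ m)) * ev p D
      = (qhalf * qhalf ^ m * p ^ m) * ev p (- D)"
    unfolding geom using \<open>p \<noteq> 1\<close> by (simp add: field_simps)
  also have "qhalf * qhalf ^ m * p ^ m = qhalf powi (1 - int m)"
    by (simp add: p_def qvar_def power_int_diff field_simps power2_eq_square power_inverse power_mult_distrib)
  finally show ?thesis using laurent_expansion[of "1 - int m" "- D"] by (simp add: p_def)
qed

end
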